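(* Let $n\ge 3$ and $m=(m_1,\ldots,m_n)$ with integers $m_i\ge 3$ for all $i$. Let $d$ be a nonzero linear derivation of $B_n^m$. Then $\ker(d)=\mathbb{C}$.
   Context: The Fermat ring is $B_n^m=\mathbb{C}[X_1,\ldots,X_n]/(X_1^{m_1}+\cdots+X_n^{m_n})$; $x_i$ denotes the residue class of $X_i$. All derivations are $\mathbb{C}$-derivations. A derivation $d$ of $B_n^m$ is called linear if there are $a_{ij}\in\mathbb{C}$ with $d(x_i)=\sum_{j=1}^n a_{ij}x_j$ for $i=1,\ldots,n$. The ring of constants of $d$ is $\ker(d)=\{r\in B_n^m\mid d(r)=0\}$. *)

theory Defs
  imports "HOL-Algebra.Algebraic_Closure_Type" "HOL-Library.Poly_Mapping" "HOL-Library.Cardinality"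
begin

text \<open>
  The polynomial ring in \<open>n\<close> variables over the complex numbers is the ring of finitely supported
  maps from exponent vectors to coefficients, with the convolution product of
  \<^theory>\<open>HOL-Library.Poly_Mapping\<close>. The index set \<open>{1, ..., n}\<close> of the variables is a finite
  type \<open>'n\<close>, with \<open>n = CARD('n)\<close>.
\<close>

type_synonym 'n cpoly = "('n \<Rightarrow>\<^sub>0 nat) \<Rightarrow>\<^sub>0 complex"

definition poly_const :: "complex \<Rightarrow> 'n cpoly"
  where "poly_const c = Poly_Mapping.single 0 c"

definition poly_var :: "'n \<Rightarrow> 'n cpoly"
  where "poly_var i = Poly_Mapping.single (Poly_Mapping.single i 1) 1"

abbreviation cpoly_ring :: "'n cpoly ring"
  where "cpoly_ring \<equiv> ring_of_type_algebra"

definition fermat_poly :: "('n::finite \<Rightarrow> nat) \<Rightarrow> 'n cpoly"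
  where "fermat_poly m = (\<Sum>i\<in>UNIV. poly_var i ^ m i)"

definition fermat_ideal :: "('n::finite \<Rightarrow> nat) \<Rightarrow> 'n cpoly set"
  where "fermat_ideal m = PIdl\<^bsub>cpoly_ring\<^esub> (fermat_poly m)"

definition fermat_ring :: "('n::finite \<Rightarrow> nat) \<Rightarrow> 'n cpoly set ring"
  where "fermat_ring m = cpoly_ring Quot (fermat_ideal m)"

definition residue_class :: "('n::finite \<Rightarrow> nat) \<Rightarrow> 'n cpoly \<Rightarrow> 'n cpoly set"
  where "residue_class m p = fermat_ideal m +>\<^bsub>cpoly_ring\<^esub> p"

definition fermat_var :: "('n::finite \<Rightarrow> nat) \<Rightarrow> 'n \<Rightarrow> 'n cpoly set"
  where "fermat_var m i = residue_class m (poly_var i)"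

definition fermat_const :: "('n::finite \<Rightarrow> nat) \<Rightarrow> complex \<Rightarrow> 'n cpoly set"
  where "fermat_const m c = residue_class m (poly_const c)"

text \<open>The copy of the field of complex numbers inside the Fermat ring.\<close>

definition fermat_scalars :: "('n::finite \<Rightarrow> nat) \<Rightarrow> 'n cpoly set set"
  where "fermat_scalars m = {fermat_const m c | c. True}"

text \<open>
  \<open>K\<close>-derivations of a ring \<open>R\<close> containing \<open>K\<close>. Only the values of \<open>d\<close> on the carrier matter.
\<close>

definition is_derivation :: "'a set \<Rightarrow> ('a, 'b) ring_scheme \<Rightarrow> ('a \<Rightarrow> 'a) \<Rightarrow> bool"
  where "is_derivation K R d \<longleftrightarrow>
    d \<in> carrier R \<rightarrow> carrier R \<and>
    (\<forall>r\<in>carrier R. \<forall>s\<in>carrier R. d (r \<oplus>\<^bsub>R\<^esub> s) = d r \<oplus>\<^bsub>R\<^esub> d s) \<and>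
    (\<forall>r\<in>carrier R. \<forall>s\<in>carrier R.
       d (r \<otimes>\<^bsub>R\<^esub> s) = (d r \<otimes>\<^bsub>R\<^esub> s) \<oplus>\<^bsub>R\<^esub> (r \<otimes>\<^bsub>R\<^esub> d s)) \<and>
    (\<forall>k\<in>K. \<forall>r\<in>carrier R. d (k \<otimes>\<^bsub>R\<^esub> r) = k \<otimes>\<^bsub>R\<^esub> d r)"

definition constants_ring :: "('a, 'b) ring_scheme \<Rightarrow> ('a \<Rightarrow> 'a) \<Rightarrow> 'a set"
  where "constants_ring R d = {r \<in> carrier R. d r = \<zero>\<^bsub>R\<^esub>}"

definition is_linear_derivation ::
    "('n::finite \<Rightarrow> nat) \<Rightarrow> ('n cpoly set \<Rightarrow> 'n cpoly set) \<Rightarrow> bool"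
  where "is_linear_derivation m d \<longleftrightarrow>
    is_derivation (fermat_scalars m) (fermat_ring m) d \<and>
    (\<exists>a :: 'n \<Rightarrow> 'n \<Rightarrow> complex. \<forall>i.
       d (fermat_var m i) =
         (\<Oplus>\<^bsub>fermat_ring m\<^esub>j\<in>UNIV. fermat_const m (a i j) \<otimes>\<^bsub>fermat_ring m\<^esub> fermat_var m j))"

end

theory Submission
  imports Defs
begin

text \<open>
  Write \<open>F = X\<^sub>1 ^ m\<^sub>1 + \<dots> + X\<^sub>n ^ m\<^sub>n\<close> and let \<open>d\<close> send \<open>x\<^sub>i\<close> to the class of
  the linear form \<open>L\<^sub>i\<close> with coefficients \<open>a i j\<close>. Every nonzero linear derivation turns out to be
  a multiple of the Euler derivation of a positive grading of the Fermat ring, and the constants of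
  such a derivation are the elements of degree 0.

  Applying \<open>d\<close> to the relation \<open>F = 0\<close> shows that \<open>F\<close> divides
  \<open>G = (\<Sum>i. m\<^sub>i X\<^sub>i ^ (m\<^sub>i - 1) L\<^sub>i)\<close>, say \<open>G = F H\<close>. A monomial in which every exponent
  of \<open>X\<^sub>k\<close> is below \<open>m\<^sub>k\<close> is divisible by no term of \<open>F\<close>, so it does not occur in \<open>F H\<close>.
  As every \<open>m\<^sub>k\<close> is at least 3, the monomials \<open>X\<^sub>i ^ (m\<^sub>i - 1) X\<^sub>j\<close> with \<open>i \<noteq> j\<close> are of
  this kind and are pairwise distinct; hence \<open>a i j = 0\<close>. The coefficient of \<open>X\<^sub>i ^ m\<^sub>i\<close> in
  \<open>F H\<close> is the constant term \<open>c\<close> of \<open>H\<close>, whatever \<open>i\<close> is; hence \<open>m\<^sub>i a i i = c\<close>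
  (lemma \<open>fermat_dvd_linear_combination\<close>). Therefore \<open>d\<close> is induced by \<open>c E\<close>, where \<open>E\<close> is
  the Euler operator that multiplies a monomial by its weight, \<open>X\<^sub>i\<close> having weight \<open>1 / m\<^sub>i\<close>
  (lemma \<open>derivation_eq_euler\<close>), and \<open>c \<noteq> 0\<close> because \<open>d\<close> is nonzero.

  It remains to see that \<open>E p = F H\<close> forces \<open>p\<close> to be constant modulo \<open>F\<close>
  (lemma \<open>fermat_dvd_euler_imp_const\<close>). Since \<open>F\<close> has weight 1,
  \<open>E (F h) = F (h + E h)\<close>, and \<open>h \<mapsto> h + E h\<close> is invertible because weights are nonnegative.
  So \<open>E p = E (F h)\<close> for some \<open>h\<close>, and \<open>p - F h\<close>, which is killed by \<open>E\<close>, is a constant,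
  since 1 is the only monomial of weight 0.
\<close>

section \<open>Polynomials as finitely supported maps\<close>

lemma poly_mapping_add_induct [case_names single add]:
  fixes f :: "'a \<Rightarrow>\<^sub>0 'b::comm_monoid_add"
  assumes single: "\<And>k v. P (Poly_Mapping.single k v)"
    and add: "\<And>f g. P f \<Longrightarrow> P g \<Longrightarrow> P (f + g)"
  shows "P f"
proof (induction f rule: Poly_Mapping.update_induct)
  case const
  show ?case using single[of undefined 0] by simp
next
  case (update f k v)
  have "Poly_Mapping.update k v f = f + Poly_Mapping.single k v"
    using update(1)
    by (intro poly_mapping_eqI)
       (auto simp: lookup_update lookup_add lookup_single when_def in_keys_iff)
  then show ?case using add[OF update(3) single] by simp
qed

lemma poly_var_power: "poly_var i ^ k = Poly_Mapping.single (Poly_Mapping.single i k) 1"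
  by (induction k)
     (simp_all add: poly_var_def mult_single single_add[symmetric] one_poly_mapping.abs_eq)

lemma poly_const_mult_single:
  "poly_const a * Poly_Mapping.single e b = Poly_Mapping.single e (a * b)"
  by (simp add: poly_const_def mult_single)

text \<open>
  A statement about an additive map satisfying the Leibniz rule passes to sums and products, so this
  rule reduces it to scalars and variables.
\<close>

lemma cpoly_induct [case_names const var add mult]:
  fixes p :: "'n cpoly"
  assumes const: "\<And>c. P (poly_const c)" and var: "\<And>i. P (poly_var i)"
    and add: "\<And>p q. P p \<Longrightarrow> P q \<Longrightarrow> P (p + q)"
    and mult: "\<And>p q. P p \<Longrightarrow> P q \<Longrightarrow> P (p * q)"
  shows "P p"
proof (induction p rule: poly_mapping_add_induct)
  case (single e c)
  have "P (Poly_Mapping.single e 1)"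
  proof (induction e rule: poly_mapping_add_induct)
    case (single i k)
    have "P (poly_var i ^ k)"
      by (induction k) (use const[of 1] var mult in \<open>simp_all add: poly_const_def\<close>)
    then show ?case by (simp add: poly_var_power)
  next
    case (add e f)
    then show ?case using mult[OF add] by (simp add: mult_single)
  qed
  from mult[OF const this] show ?case by (simp add: poly_const_mult_single)
qed (rule add)

text \<open>
  Multiplication by a monomial shifts the coefficients. Exponents cannot be subtracted freely, so
  the exponents that are reached by the shift and those that are not are treated separately.
\<close>

lemma lookup_single_mult:
  fixes H :: "('a::cancel_comm_monoid_add) \<Rightarrow>\<^sub>0 ('b::comm_semiring_1)"
  shows "Poly_Mapping.lookup (Poly_Mapping.single s a * H) (s + e) = a * Poly_Mapping.lookup H e"
  by (induction H rule: poly_mapping_add_induct)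
     (simp_all add: mult_single lookup_single when_def lookup_add distrib_left)

lemma lookup_single_mult_eq_0:
  fixes H :: "('a::cancel_comm_monoid_add) \<Rightarrow>\<^sub>0 ('b::comm_semiring_1)"
  assumes "\<And>t. e \<noteq> s + t"
  shows "Poly_Mapping.lookup (Poly_Mapping.single s a * H) e = 0"
  using assms
  by (induction H rule: poly_mapping_add_induct)
     (force simp add: mult_single lookup_single when_def lookup_add distrib_left)+

section \<open>Coefficients of multiples of the Fermat polynomial\<close>

lemma fermat_poly_eq:
  "fermat_poly m = (\<Sum>i\<in>UNIV. Poly_Mapping.single (Poly_Mapping.single i (m i)) 1)"
  by (simp add: fermat_poly_def poly_var_power)

text \<open>No term \<open>X\<^sub>i ^ m\<^sub>i\<close> of the Fermat polynomial divides the monomial with exponent \<open>e\<close>.\<close>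

lemma lookup_fermat_mult_reduced:
  assumes "\<And>i. Poly_Mapping.lookup e i < m i"
  shows "Poly_Mapping.lookup (fermat_poly m * H) e = 0"
proof -
  have "e \<noteq> Poly_Mapping.single i (m i) + t" for i t
    using assms[of i] by (auto simp: lookup_add)
  then show ?thesis
    by (simp add: fermat_poly_eq sum_distrib_right lookup_sum lookup_single_mult_eq_0)
qed

text \<open>
  Only the term \<open>X\<^sub>i ^ m\<^sub>i\<close> of the Fermat polynomial divides \<open>X\<^sub>i ^ m\<^sub>i\<close>. The point is that the
  value does not depend on \<open>i\<close>.
\<close>

lemma lookup_fermat_mult_pure_power:
  assumes "\<And>i. m i > 0"
  shows "Poly_Mapping.lookup (fermat_poly m * H) (Poly_Mapping.single i (m i))
    = Poly_Mapping.lookup H 0"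
proof -
  let ?t = "\<lambda>k. Poly_Mapping.lookup (Poly_Mapping.single (Poly_Mapping.single k (m k)) 1 * H)
    (Poly_Mapping.single i (m i))"
  have ii: "?t i = Poly_Mapping.lookup H 0"
    using lookup_single_mult[of "Poly_Mapping.single i (m i)" 1 H 0] by simp
  have ki: "?t k = 0" if "k \<noteq> i" for k
  proof (rule lookup_single_mult_eq_0)
    fix t
    show "Poly_Mapping.single i (m i) \<noteq> Poly_Mapping.single k (m k) + t"
    proof
      assume "Poly_Mapping.single i (m i) = Poly_Mapping.single k (m k) + t"
      then have "Poly_Mapping.lookup (Poly_Mapping.single i (m i)) k =
        Poly_Mapping.lookup (Poly_Mapping.single k (m k) + t) k" by simp
      then show False using that assms[of k] by (simp add: lookup_add lookup_single)
    qed
  qed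
  have "Poly_Mapping.lookup (fermat_poly m * H) (Poly_Mapping.single i (m i)) = (\<Sum>k\<in>UNIV. ?t k)"
    by (simp add: fermat_poly_eq sum_distrib_right lookup_sum)
  also have "\<dots> = ?t i" by (rule sum.mono_neutral_cong_right[where S="{i}", simplified]) (use ki in auto)
  finally show ?thesis using ii by simp
qed

definition linear_form :: "('n::finite \<Rightarrow> complex) \<Rightarrow> 'n cpoly"
  where "linear_form b = (\<Sum>j\<in>UNIV. poly_const (b j) * poly_var j)"

lemma linear_form_diagonal:
  assumes "\<And>j. j \<noteq> i \<Longrightarrow> b j = 0"
  shows "linear_form b = poly_const (b i) * poly_var i"
  unfolding linear_form_def
  by (rule sum.mono_neutral_cong_right[where S="{i}", simplified])
     (use assms in \<open>auto simp: poly_const_def\<close>)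

text \<open>
  The exponent \<open>m\<^sub>k - 1 \<ge> 2\<close> is too large to come from a linear factor, so the variable \<open>k\<close> can be
  read off from \<open>X\<^sub>k ^ (m\<^sub>k - 1) X\<^sub>l\<close>. With \<open>m\<^sub>k = m\<^sub>l = 2\<close> one could exchange \<open>k\<close> and \<open>l\<close>.
\<close>

lemma mixed_exponent_inject:
  assumes m: "\<And>i. m i \<ge> (3::nat)"
    and eq: "Poly_Mapping.single k (m k - 1) + Poly_Mapping.single l 1 =
      Poly_Mapping.single i (m i - 1) + Poly_Mapping.single j (1::nat)"
  shows "k = i \<and> l = j"
proof -
  have "Poly_Mapping.lookup (Poly_Mapping.single k (m k - 1) + Poly_Mapping.single l 1) k =
      Poly_Mapping.lookup (Poly_Mapping.single i (m i - 1) + Poly_Mapping.single j 1) k"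
    using eq by simp
  then have ki: "k = i"
    using m[of k] by (auto simp: lookup_add lookup_single when_def split: if_splits)
  with eq have "Poly_Mapping.single l 1 = Poly_Mapping.single j (1::nat)" by simp
  then have "Poly_Mapping.lookup (Poly_Mapping.single l (1::nat)) l =
     Poly_Mapping.lookup (Poly_Mapping.single j 1) l" by simp
  then have "l = j" by (simp add: lookup_single when_def split: if_splits)
  with ki show ?thesis by simp
qed

text \<open>
  The combination below is the image of the Fermat polynomial under the derivation
  \<open>X\<^sub>i \<mapsto> L\<^sub>i\<close>. Comparing its coefficients with those of a multiple of the Fermat polynomial leaves
  one free parameter, the constant term of the cofactor.
\<close>

lemma fermat_dvd_linear_combination:
  fixes a :: "'n::finite \<Rightarrow> 'n \<Rightarrow> complex"
  assumes m: "\<And>i. m i \<ge> 3"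
    and dvd: "fermat_poly m dvd
      (\<Sum>i\<in>UNIV. of_nat (m i) * poly_var i ^ (m i - 1) * linear_form (a i))"
  obtains c where "\<And>i j. j \<noteq> i \<Longrightarrow> a i j = 0" "\<And>i. a i i = c / of_nat (m i)"
proof -
  let ?e = "\<lambda>i j. Poly_Mapping.single i (m i - 1) + Poly_Mapping.single j 1"
  let ?G = "\<Sum>i\<in>UNIV. of_nat (m i) * poly_var i ^ (m i - 1) * linear_form (a i)"
  obtain H where H: "?G = fermat_poly m * H" using dvd by (auto elim: dvdE)
  have "?G = (\<Sum>i\<in>UNIV. \<Sum>j\<in>UNIV. Poly_Mapping.single (?e i j) (of_nat (m i) * a i j))"
    unfolding poly_var_power linear_form_def
    by (simp add: sum_distrib_left poly_var_def poly_const_def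
        mult_single single_of_nat[symmetric] del: single_of_nat)
  then have "Poly_Mapping.lookup ?G (?e i j) =
     (\<Sum>k\<in>UNIV. \<Sum>l\<in>UNIV. (of_nat (m k) * a k l when ?e k l = ?e i j))" for i j
    by (simp add: lookup_sum lookup_single)
  moreover have "(\<Sum>k\<in>UNIV. \<Sum>l\<in>UNIV. (of_nat (m k) * a k l when ?e k l = ?e i j)) =
     (\<Sum>k\<in>UNIV. \<Sum>l\<in>UNIV. (if k = i \<and> l = j then of_nat (m i) * a i j else 0))" for i j
    using mixed_exponent_inject[where m = m, OF m] by (intro sum.cong refl) (auto simp: when_def)
  moreover have "(\<Sum>k\<in>UNIV. \<Sum>l\<in>UNIV. (if k = i \<and> l = j then of_nat (m i) * a i j else 0)) =
     of_nat (m i) * a i j" for i j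
  proof -
    have "(\<Sum>l\<in>UNIV. (if k = i \<and> l = j then of_nat (m i) * a i j else 0)) =
      (if k = i then of_nat (m i) * a i j else 0)" for k
      by (cases "k = i") simp_all
    then show ?thesis by simp
  qed
  ultimately have G: "Poly_Mapping.lookup ?G (?e i j) = of_nat (m i) * a i j" for i j
    by simp
  have m0: "m i \<noteq> 0" for i using m[of i] by simp
  \<comment> \<open>For \<open>j \<noteq> i\<close> the exponents \<open>m i - 1\<close> and \<open>1\<close> are both too small.\<close>
  have "a i j = 0" if "j \<noteq> i" for i j
  proof -
    have "Poly_Mapping.lookup (?e i j) k < m k" for k
      using that m[of k] by (auto simp: lookup_add lookup_single when_def)
    from lookup_fermat_mult_reduced[OF this] have "of_nat (m i) * a i j = 0"
      using G H by metis
    then show ?thesis using m0[of i] by simp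
  qed
  moreover have "a i i = Poly_Mapping.lookup H 0 / of_nat (m i)" for i
  proof -
    have "?e i i = Poly_Mapping.single i (m i)"
      using m0[of i] by (simp add: single_add[symmetric])
    moreover have "\<And>i. m i > 0" using m0 by simp
    ultimately have "of_nat (m i) * a i i = Poly_Mapping.lookup H 0"
      using G[of i i] H lookup_fermat_mult_pure_power[of m H i] by simp
    then show ?thesis using m0[of i] by (simp add: field_simps)
  qed
  ultimately show ?thesis using that by blast
qed

section \<open>The weighted Euler operator\<close>

text \<open>
  If all exponents are positive, the Fermat polynomial is homogeneous of weight 1. Weights are rational; they
  take values in the complex numbers because they multiply coefficients.
\<close>

definition weight :: "('n::finite \<Rightarrow> nat) \<Rightarrow> ('n \<Rightarrow>\<^sub>0 nat) \<Rightarrow> complex"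
  where "weight m e = (\<Sum>i\<in>UNIV. of_nat (Poly_Mapping.lookup e i) / of_nat (m i))"

definition euler :: "('n::finite \<Rightarrow> nat) \<Rightarrow> 'n cpoly \<Rightarrow> 'n cpoly"
  where "euler m p = Poly_Mapping.mapp (\<lambda>e. (*) (weight m e)) p"

lemma lookup_euler: "Poly_Mapping.lookup (euler m p) e = weight m e * Poly_Mapping.lookup p e"
  by (simp add: euler_def lookup_mapp when_def in_keys_iff)

lemma weight_add: "weight m (e + f) = weight m e + weight m f"
  by (simp add: weight_def lookup_add add_divide_distrib sum.distrib)

lemma weight_single: "weight m (Poly_Mapping.single i k) = of_nat k / of_nat (m i)"
  unfolding weight_def
  by (rule trans[OF sum.mono_neutral_cong_right[where S="{i}", simplified]])
     (auto simp: lookup_single when_def)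

text \<open>Positivity arguments need the weight as a real number.\<close>

lemma weight_eq_of_real:
  "weight m e = of_real (\<Sum>i\<in>UNIV. real (Poly_Mapping.lookup e i) / real (m i))"
  by (simp add: weight_def)

lemma weight_eq_0_iff:
  assumes "\<And>i. m i > 0"
  shows "weight m e = 0 \<longleftrightarrow> e = 0"
proof
  assume "weight m e = 0"
  then have "(\<Sum>i\<in>UNIV. real (Poly_Mapping.lookup e i) / real (m i)) = 0"
    by (simp only: weight_eq_of_real of_real_eq_0_iff)
  then have "\<And>i. real (Poly_Mapping.lookup e i) / real (m i) = 0"
    by (subst (asm) sum_nonneg_eq_0_iff) auto
  then have "Poly_Mapping.lookup e i = 0" for i
    using assms[of i] by (metis divide_eq_0_iff less_irrefl of_nat_eq_0_iff)
  then show "e = 0" by (intro poly_mapping_eqI) simp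
qed (simp add: weight_def)

lemma weight_plus_1_neq_0: "weight m e + 1 \<noteq> 0"
proof -
  have "(\<Sum>i\<in>UNIV. real (Poly_Mapping.lookup e i) / real (m i)) \<ge> 0"
    by (intro sum_nonneg) auto
  then have "(\<Sum>i\<in>UNIV. real (Poly_Mapping.lookup e i) / real (m i)) + 1 \<noteq> 0" by linarith
  moreover have "weight m e + 1 =
      of_real ((\<Sum>i\<in>UNIV. real (Poly_Mapping.lookup e i) / real (m i)) + 1)"
    by (simp only: weight_eq_of_real of_real_add of_real_1)
  ultimately show ?thesis by (simp only: of_real_eq_0_iff) simp
qed

lemma euler_add: "euler m (p + q) = euler m p + euler m q"
  by (intro poly_mapping_eqI) (simp add: lookup_euler lookup_add distrib_left)

lemma euler_single:
  "euler m (Poly_Mapping.single e a) = Poly_Mapping.single e (weight m e * a)"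
  by (intro poly_mapping_eqI) (auto simp: lookup_euler lookup_single when_def)

text \<open>On monomials the Leibniz rule is the additivity of the weight.\<close>

lemma euler_mult: "euler m (p * q) = euler m p * q + p * euler m q"
proof (induction p rule: poly_mapping_add_induct)
  case (single e a)
  show ?case
  proof (induction q rule: poly_mapping_add_induct)
    case (single f b)
    show ?case
      by (simp add: mult_single euler_single weight_add single_add[symmetric] algebra_simps)
  next
    case (add f g)
    then show ?case by (simp add: distrib_left euler_add algebra_simps)
  qed
next
  case (add f g)
  then show ?case by (simp add: distrib_right euler_add algebra_simps)
qed

lemma euler_fermat_poly:
  assumes "\<And>i. m i > 0"
  shows "euler m (fermat_poly m) = fermat_poly m"
proof -
  have "euler m (\<Sum>i\<in>A. f i) = (\<Sum>i\<in>A. euler m (f i))" if "finite A"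
    for A :: "'a set" and f :: "'a \<Rightarrow> 'a cpoly"
    using that by induction (simp_all add: euler_add poly_mapping_eqI lookup_euler)
  moreover have "euler m (Poly_Mapping.single (Poly_Mapping.single i (m i)) 1) =
      Poly_Mapping.single (Poly_Mapping.single i (m i)) 1" for i
    using assms[of i] by (simp add: euler_single weight_single)
  ultimately show ?thesis by (simp add: fermat_poly_eq)
qed

text \<open>
  A multiple \<open>F H\<close> of the Fermat polynomial is the image of another multiple \<open>F h\<close> under the Euler
  operator. So if \<open>euler m p = F H\<close>, then \<open>p\<close> and \<open>F h\<close> have the same image, and they differ by an
  element of the kernel of the Euler operator, which consists of the scalars.
\<close>

lemma fermat_dvd_euler_imp_const:
  assumes m: "\<And>i. m i > 0" and dvd: "fermat_poly m dvd euler m p"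
  obtains b where "fermat_poly m dvd p - poly_const b"
proof -
  obtain H where H: "euler m p = fermat_poly m * H" using dvd by (auto elim: dvdE)
  \<comment> \<open>The Euler operator acts on \<open>F\<close> times a monomial of weight \<open>w\<close> as multiplication by \<open>w + 1\<close>.\<close>
  define h where "h = Poly_Mapping.mapp (\<lambda>e x. x / (weight m e + 1)) H"
  have h: "Poly_Mapping.lookup h e = Poly_Mapping.lookup H e / (weight m e + 1)" for e
    by (simp add: h_def lookup_mapp when_def in_keys_iff)
  have "h + euler m h = H"
  proof (rule poly_mapping_eqI)
    fix e
    have "x / (weight m e + 1) + weight m e * (x / (weight m e + 1)) = x" for x
      using weight_plus_1_neq_0[of m e] by (simp add: divide_simps) (simp add: algebra_simps)
    then show "Poly_Mapping.lookup (h + euler m h) e = Poly_Mapping.lookup H e"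
      by (simp add: lookup_add lookup_euler h)
  qed
  then have "euler m (fermat_poly m * h) = fermat_poly m * H"
    by (simp add: euler_mult euler_fermat_poly[OF m] distrib_left[symmetric])
  then have eq: "weight m e * Poly_Mapping.lookup p e =
      weight m e * Poly_Mapping.lookup (fermat_poly m * h) e" for e
    using H by (simp add: lookup_euler[symmetric])
  define b where "b = Poly_Mapping.lookup (p - fermat_poly m * h) 0"
  have "p - fermat_poly m * h = poly_const b"
  proof (rule poly_mapping_eqI)
    fix e
    show "Poly_Mapping.lookup (p - fermat_poly m * h) e = Poly_Mapping.lookup (poly_const b) e"
      using eq[of e] weight_eq_0_iff[where m = m and e = e, OF m]
      by (cases "e = 0") (auto simp: b_def poly_const_def lookup_single lookup_minus)
  qed
  then have "p - poly_const b = fermat_poly m * h" by (simp add: algebra_simps)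
  then have "fermat_poly m dvd p - poly_const b" by simp
  then show ?thesis by (rule that)
qed

section \<open>Residue classes\<close>

lemma cpoly_ring_simps [simp]:
  "carrier (cpoly_ring :: 'n cpoly ring) = UNIV"
  "p \<otimes>\<^bsub>cpoly_ring :: 'n cpoly ring\<^esub> q = p * q"
  "p \<oplus>\<^bsub>cpoly_ring :: 'n cpoly ring\<^esub> q = p + q"
  "\<one>\<^bsub>cpoly_ring :: 'n cpoly ring\<^esub> = 1"
  "\<zero>\<^bsub>cpoly_ring :: 'n cpoly ring\<^esub> = 0"
  by (simp_all add: ring_of_type_algebra_def)

lemma cring_cpoly_ring: "cring (cpoly_ring :: 'n cpoly ring)"
  by (rule cring_from_type_algebra)

lemma minus_cpoly_ring: "p \<ominus>\<^bsub>cpoly_ring :: 'n cpoly ring\<^esub> q = p - q"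
proof -
  interpret cring "cpoly_ring :: 'n cpoly ring" by (rule cring_cpoly_ring)
  have "\<ominus>\<^bsub>cpoly_ring :: 'n cpoly ring\<^esub> q = - q" by (rule minus_equality) simp_all
  then show ?thesis by (simp add: a_minus_def)
qed

lemma ideal_fermat_ideal: "ideal (fermat_ideal m) cpoly_ring"
  unfolding fermat_ideal_def by (intro cring.cgenideal_ideal cring_cpoly_ring) simp

lemma fermat_ideal_iff: "p \<in> fermat_ideal m \<longleftrightarrow> fermat_poly m dvd p"
  by (auto simp: fermat_ideal_def cgenideal_def dvd_def mult.commute)

lemma cring_fermat_ring: "cring (fermat_ring m)"
  unfolding fermat_ring_def
  by (rule ideal.quotient_is_cring[OF ideal_fermat_ideal cring_cpoly_ring])

lemma residue_class_ring_hom: "residue_class m \<in> ring_hom cpoly_ring (fermat_ring m)"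
  using ideal.rcos_ring_hom[OF ideal_fermat_ideal[of m]]
  by (simp add: fermat_ring_def residue_class_def[abs_def])

lemma residue_class_add: "residue_class m p \<oplus>\<^bsub>fermat_ring m\<^esub> residue_class m q = residue_class m (p + q)"
  using ring_hom_add[OF residue_class_ring_hom, of p q m] by simp

lemma residue_class_mult: "residue_class m p \<otimes>\<^bsub>fermat_ring m\<^esub> residue_class m q = residue_class m (p * q)"
  using ring_hom_mult[OF residue_class_ring_hom, of p q m] by simp

lemma residue_class_zero: "\<zero>\<^bsub>fermat_ring m\<^esub> = residue_class m 0"
proof -
  interpret ideal "fermat_ideal m" cpoly_ring by (rule ideal_fermat_ideal)
  show ?thesis
    using ring_hom_zero[OF residue_class_ring_hom[of m] ring_axioms cring.axioms(1)[OF cring_fermat_ring]]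
    by simp
qed

lemma carrier_fermat_ring: "carrier (fermat_ring m) = range (residue_class m)"
  by (auto simp: fermat_ring_def FactRing_def A_RCOSETS_def' residue_class_def)

lemma residue_class_eq_iff: "residue_class m p = residue_class m q \<longleftrightarrow> fermat_poly m dvd p - q"
  using ring.quotient_eq_iff_same_a_r_cos[OF cring.axioms(1)[OF cring_cpoly_ring] ideal_fermat_ideal[of m], of p q]
  by (simp add: residue_class_def minus_cpoly_ring fermat_ideal_iff)

lemma residue_class_sum:
  assumes "finite A"
  shows "(\<Oplus>\<^bsub>fermat_ring m\<^esub>i\<in>A. residue_class m (f i)) = residue_class m (\<Sum>i\<in>A. f i)"
  using assms
proof induction
  interpret cring "fermat_ring m" by (rule cring_fermat_ring)
  {
    case empty
    show ?case by (simp add: residue_class_zero)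
  next
    case (insert x A)
    then show ?case
      by (subst finsum_insert) (auto simp: carrier_fermat_ring residue_class_add)
  }
qed

section \<open>Derivations of the Fermat ring\<close>

text \<open>
  A derivation of the quotient is handled through polynomial representatives of its values. These are
  not unique, so the rules below state which classes are images, without choosing a lift of the
  derivation to the polynomial ring.
\<close>

lemma is_linear_derivationE:
  assumes "is_linear_derivation m d"
  obtains a where
    "is_derivation (fermat_scalars m) (fermat_ring m) d"
    "\<And>i. d (residue_class m (poly_var i)) = residue_class m (linear_form (a i))"
  using assms
  by (auto simp: is_linear_derivation_def fermat_var_def fermat_const_def residue_class_mult
      residue_class_sum linear_form_def)

context
  fixes m :: "'n::finite \<Rightarrow> nat" and d
  assumes der: "is_derivation (fermat_scalars m) (fermat_ring m) d"
begin

lemma derivation_lift: "\<exists>q. d (residue_class m p) = residue_class m q"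
proof -
  have "d \<in> range (residue_class m) \<rightarrow> range (residue_class m)"
    using der by (simp add: is_derivation_def carrier_fermat_ring)
  then have "d (residue_class m p) \<in> range (residue_class m)" by (rule funcset_mem) simp
  then show ?thesis by (simp add: image_iff)
qed

lemma derivation_add:
  assumes "d (residue_class m p) = residue_class m p'" "d (residue_class m q) = residue_class m q'"
  shows "d (residue_class m (p + q)) = residue_class m (p' + q')"
proof -
  have "d (residue_class m p \<oplus>\<^bsub>fermat_ring m\<^esub> residue_class m q) =
      d (residue_class m p) \<oplus>\<^bsub>fermat_ring m\<^esub> d (residue_class m q)"
    using der unfolding is_derivation_def carrier_fermat_ring by blast
  then show ?thesis by (simp only: assms residue_class_add)
qed

lemma derivation_mult:
  assumes "d (residue_class m p) = residue_class m p'" "d (residue_class m q) = residue_class m q'"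
  shows "d (residue_class m (p * q)) = residue_class m (p' * q + p * q')"
proof -
  have "d (residue_class m p \<otimes>\<^bsub>fermat_ring m\<^esub> residue_class m q) =
      (d (residue_class m p) \<otimes>\<^bsub>fermat_ring m\<^esub> residue_class m q) \<oplus>\<^bsub>fermat_ring m\<^esub>
      (residue_class m p \<otimes>\<^bsub>fermat_ring m\<^esub> d (residue_class m q))"
    using der unfolding is_derivation_def carrier_fermat_ring by blast
  then show ?thesis by (simp only: assms residue_class_add residue_class_mult)
qed

text \<open>As usual, \<open>d 1 = d (1 * 1) = d 1 + d 1\<close>, and scalars can be moved out of \<open>d\<close>.\<close>

lemma derivation_const: "d (residue_class m (poly_const c)) = residue_class m 0"
proof -
  obtain u where u: "d (residue_class m 1) = residue_class m u" using derivation_lift by blast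
  have "residue_class m u = residue_class m (u + u)"
    using derivation_mult[OF u u] u by simp
  then have "residue_class m u = residue_class m 0"
    by (simp add: residue_class_eq_iff)
  with u have one: "d (residue_class m 1) = residue_class m 0" by simp
  have "residue_class m (poly_const c) \<in> fermat_scalars m"
    by (auto simp: fermat_scalars_def fermat_const_def)
  moreover have "residue_class m 1 \<in> carrier (fermat_ring m)" by (simp add: carrier_fermat_ring)
  ultimately have "d (residue_class m (poly_const c) \<otimes>\<^bsub>fermat_ring m\<^esub> residue_class m 1) =
      residue_class m (poly_const c) \<otimes>\<^bsub>fermat_ring m\<^esub> d (residue_class m 1)"
    using der unfolding is_derivation_def by blast
  then show ?thesis by (simp add: one residue_class_mult)
qed

lemma derivation_sum:
  assumes "finite A" "\<And>i. i \<in> A \<Longrightarrow> d (residue_class m (f i)) = residue_class m (g i)"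
  shows "d (residue_class m (\<Sum>i\<in>A. f i)) = residue_class m (\<Sum>i\<in>A. g i)"
  using assms
proof (induction)
  case empty
  show ?case using derivation_const[of 0] by (simp add: poly_const_def)
next
  case (insert x A)
  then show ?case by (simp add: derivation_add)
qed

lemma derivation_power:
  assumes "d (residue_class m p) = residue_class m q"
  shows "d (residue_class m (p ^ k)) = residue_class m (of_nat k * p ^ (k - 1) * q)"
proof (induction k)
  case 0
  show ?case using derivation_const[of 1] by (simp add: poly_const_def)
next
  case (Suc k)
  have "q * p ^ k + p * (of_nat k * p ^ (k - 1) * q) = of_nat (Suc k) * p ^ (Suc k - 1) * q"
    by (cases k) (simp_all add: algebra_simps)
  with derivation_mult[OF assms Suc] show ?case by simp
qed

text \<open>The Fermat polynomial vanishes in the Fermat ring, hence so does its derivative.\<close>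

lemma derivation_fermat_relation:
  assumes "\<And>i. d (residue_class m (poly_var i)) = residue_class m (L i)"
  shows "fermat_poly m dvd (\<Sum>i\<in>UNIV. of_nat (m i) * poly_var i ^ (m i - 1) * L i)"
proof -
  have "d (residue_class m (fermat_poly m)) =
      residue_class m (\<Sum>i\<in>UNIV. of_nat (m i) * poly_var i ^ (m i - 1) * L i)"
    unfolding fermat_poly_def by (intro derivation_sum derivation_power assms) simp
  moreover have "residue_class m (fermat_poly m) = residue_class m 0"
    by (simp add: residue_class_eq_iff)
  moreover have "d (residue_class m 0) = residue_class m 0"
    using derivation_const[of 0] by (simp add: poly_const_def)
  ultimately have "residue_class m (\<Sum>i\<in>UNIV. of_nat (m i) * poly_var i ^ (m i - 1) * L i) =
      residue_class m 0" by simp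
  then show ?thesis by (simp add: residue_class_eq_iff)
qed

text \<open>Both sides satisfy the Leibniz rule, so it is enough that they agree on the variables.\<close>

lemma derivation_eq_euler:
  assumes "\<And>i. d (residue_class m (poly_var i)) =
    residue_class m (poly_const (c / of_nat (m i)) * poly_var i)"
  shows "d (residue_class m p) = residue_class m (poly_const c * euler m p)"
proof (induction p rule: cpoly_induct)
  case (const b)
  have "euler m (poly_const b) = 0" by (simp add: poly_const_def euler_single weight_def)
  then show ?case by (simp add: derivation_const)
next
  case (var i)
  have "poly_const c * euler m (poly_var i) = poly_const (c / of_nat (m i)) * poly_var i"
    by (simp add: poly_var_def euler_single weight_single poly_const_mult_single)
  then show ?case by (simp add: assms)
next
  case (add p q)
  show ?case using derivation_add[OF add] by (simp add: euler_add distrib_left)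
next
  case (mult p q)
  show ?case using derivation_mult[OF mult] by (simp add: euler_mult algebra_simps)
qed

end

theorem theorem13:
  fixes m :: "'n::finite \<Rightarrow> nat"
    and d :: "'n cpoly set \<Rightarrow> 'n cpoly set"
  assumes "CARD('n) \<ge> 3"
    and "\<And>i. m i \<ge> 3"
    and "is_linear_derivation m d"
    and "\<exists>r\<in>carrier (fermat_ring m). d r \<noteq> \<zero>\<^bsub>fermat_ring m\<^esub>"
  shows "constants_ring (fermat_ring m) d = fermat_scalars m"
proof -
  have m: "m i > 0" for i using assms(2)[of i] by simp
  obtain a where der: "is_derivation (fermat_scalars m) (fermat_ring m) d"
    and a: "\<And>i. d (residue_class m (poly_var i)) = residue_class m (linear_form (a i))"
    using is_linear_derivationE[OF assms(3)] by blast
  obtain c where "\<And>i j. j \<noteq> i \<Longrightarrow> a i j = 0" and "\<And>i. a i i = c / of_nat (m i)"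
    using fermat_dvd_linear_combination[OF assms(2) derivation_fermat_relation[OF der a]] by blast
  then have "linear_form (a i) = poly_const (c / of_nat (m i)) * poly_var i" for i
    using linear_form_diagonal[of i "a i"] by simp
  then have d: "d (residue_class m p) = residue_class m (poly_const c * euler m p)" for p
    by (intro derivation_eq_euler[OF der]) (simp add: a)
  have c: "c \<noteq> 0"
  proof
    assume "c = 0"
    then have "d (residue_class m p) = \<zero>\<^bsub>fermat_ring m\<^esub>" for p
      by (simp add: d poly_const_def residue_class_zero)
    then show False using assms(4) by (auto simp: carrier_fermat_ring)
  qed
  have "r \<in> fermat_scalars m" if "r \<in> constants_ring (fermat_ring m) d" for r
  proof -
    have "r \<in> carrier (fermat_ring m)" and dr: "d r = \<zero>\<^bsub>fermat_ring m\<^esub>"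
      using that by (simp_all add: constants_ring_def)
    then obtain p where p: "r = residue_class m p" unfolding carrier_fermat_ring by blast
    have "residue_class m (poly_const c * euler m p) = residue_class m 0"
      using dr by (simp only: p d residue_class_zero)
    then have "fermat_poly m dvd poly_const c * euler m p"
      by (simp add: residue_class_eq_iff)
    \<comment> \<open>The scalar \<open>c\<close> is a unit.\<close>
    then have "fermat_poly m dvd poly_const (1 / c) * (poly_const c * euler m p)"
      by (rule dvd_mult)
    moreover have "poly_const (1 / c) * (poly_const c * euler m p) = euler m p"
      using c by (simp add: poly_const_def mult.assoc[symmetric] mult_single)
    ultimately obtain b where "fermat_poly m dvd p - poly_const b"
      using fermat_dvd_euler_imp_const[where m = m and p = p, OF m] by auto
    then have "r = fermat_const m b"
      by (simp add: p fermat_const_def residue_class_eq_iff)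
    then show ?thesis by (auto simp: fermat_scalars_def)
  qed
  moreover have "r \<in> constants_ring (fermat_ring m) d" if "r \<in> fermat_scalars m" for r
    using that derivation_const[OF der]
    by (auto simp: constants_ring_def fermat_scalars_def fermat_const_def carrier_fermat_ring
        residue_class_zero)
  ultimately show ?thesis by blast
qed

end
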